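(* Let $d\ge1$. Suppose $\kappa_d$ is algebraic, let $K=\mathbb{Q}(\kappa_d)$, and assume that $p^k\in E_d$ for some prime $p$ and some $k\ge1$. Then: (1) $\kappa_d$ is $\mathfrak p$-integral (i.e. $v_{\mathfrak p}(\kappa_d)\ge0$) at every prime $\mathfrak p$ of $K$ above $p$; (2) $\kappa_d\equiv1\pmod{\mathfrak p}$ for every such $\mathfrak p$. Hence the reduction of $\kappa_d$ in the residue field $k_{\mathfrak p}$ of $\mathcal{O}_K$ at $\mathfrak p$ agrees with the reduction of $\kappa_d^{(p)}\in1+p\mathbb{Z}_p$.
   Context: For integers $d,n\ge1$, $T_d(n)$ is the Cayley graph of $(\mathbb{Z}/n\mathbb{Z})^d$ with respect to $\{\pm e_1,\dots,\pm e_d\}\setminus\{0\}$ ($e_i$ the standard basis vectors); it is a simple graph, and $T_d(1)$ is a single vertex with no edges. $a_d(n)$ is the number of independent sets of $T_d(n)$ (including the empty set). The limit $\kappa_d=\lim_{n\to\infty}a_d(n)^{1/n^d}$ exists and is a positive real number. $E_d=\{n\ge1: a_d(n)=\kappa_d^{n^d}\}$. For every prime $p$, the sequence $\{a_d(p^k)\}_{k\ge1}$ converges in $\mathbb{Z}_p$ to a limit $\kappa_d^{(p)}$, which lies in $1+p\mathbb{Z}_p$; its reduction in $k_{\mathfrak p}$ is its image under $\mathbb{Z}_p\to\mathbb{F}_p\subseteq k_{\mathfrak p}$. $\mathcal{O}_K$ is the ring of integers of $K$ and $v_{\mathfrak p}$ is the valuation attached to the prime ideal $\mathfrak p$ of $\mathcal{O}_K$.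 *)

theory Defs
  imports
    "HOL-Analysis.Analysis"
    "HOL-Algebra.Algebra"
    "HOL-Algebra.Algebraic_Closure_Type"
    "HOL-Number_Theory.Number_Theory"
begin

section \<open>Independent sets of the discrete torus\<close>

definition torus_group :: "nat \<Rightarrow> nat \<Rightarrow> (nat \<Rightarrow> int) monoid" where
  "torus_group d n = product_group {..<d} (\<lambda>_. integer_mod_group n)"

text \<open>The reduction \<open>mod n\<close> matters for \<open>n = 1\<close>, where the basis vectors are zero.\<close>

definition basis_vector :: "nat \<Rightarrow> nat \<Rightarrow> nat \<Rightarrow> (nat \<Rightarrow> int)" where
  "basis_vector d n i = (\<lambda>j\<in>{..<d}. (if j = i then 1 else 0) mod int n)"

definition torus_generators :: "nat \<Rightarrow> nat \<Rightarrow> (nat \<Rightarrow> int) set" where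
  "torus_generators d n =
     (\<Union>i<d. {basis_vector d n i, inv\<^bsub>torus_group d n\<^esub> (basis_vector d n i)})
       - {\<one>\<^bsub>torus_group d n\<^esub>}"

definition cayley_edges :: "('a, 'b) monoid_scheme \<Rightarrow> 'a set \<Rightarrow> 'a set set" where
  "cayley_edges G S = {{x, x \<otimes>\<^bsub>G\<^esub> s} | x s. x \<in> carrier G \<and> s \<in> S}"

definition independent_sets :: "'a set \<Rightarrow> 'a set set \<Rightarrow> 'a set set" where
  "independent_sets V E = {A. A \<subseteq> V \<and> (\<forall>e\<in>E. \<not> e \<subseteq> A)}"

definition num_indep :: "nat \<Rightarrow> nat \<Rightarrow> nat" where
  "num_indep d n =
     card (independent_sets (carrier (torus_group d n))
            (cayley_edges (torus_group d n) (torus_generators d n)))"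

definition kappa :: "nat \<Rightarrow> real" where
  "kappa d = lim (\<lambda>n. real (num_indep d n) powr (1 / real (n ^ d)))"

definition exact_set :: "nat \<Rightarrow> nat set" where
  "exact_set d = {n. n \<ge> 1 \<and> real (num_indep d n) = kappa d ^ (n ^ d)}"


section \<open>Primes of a number field\<close>

text \<open>Number fields are subfields of \<open>\<real>\<close> here, which is enough for \<open>\<rat>(x)\<close> with \<open>x\<close> real.\<close>

definition rat_adjoin :: "real \<Rightarrow> real set" where
  "rat_adjoin x = generate_field ring_of_type_algebra (insert x \<rat>)"

definition ring_of_ints :: "real set \<Rightarrow> real ring" where
  "ring_of_ints K = ring_of_type_algebra\<lparr>carrier := {x \<in> K. algebraic_int x}\<rparr>"

definition prime_above :: "real set \<Rightarrow> nat \<Rightarrow> real set \<Rightarrow> bool" where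
  "prime_above K p P \<longleftrightarrow>
     primeideal P (ring_of_ints K) \<and> {m :: int. of_int m \<in> P} = {m. int p dvd m}"

definition local_ring :: "real set \<Rightarrow> real set \<Rightarrow> real set" where
  "local_ring K P =
     {a / s | a s. a \<in> carrier (ring_of_ints K) \<and> s \<in> carrier (ring_of_ints K) - P}"

text \<open>The fractional ideal \<open>P\<^sup>m O\<^bsub>K,P\<^esub>\<close> of the local ring at \<open>P\<close>; for \<open>m < 0\<close> it is the
  colon \<open>(O\<^bsub>K,P\<^esub> : P\<^bsup>-m\<^esup>)\<close>. The monoid \<^const>\<open>ideals_set\<close> supplies powers of ideals.\<close>

definition local_power :: "real set \<Rightarrow> real set \<Rightarrow> int \<Rightarrow> real set" where
  "local_power K P m =
     (if m \<ge> 0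
      then {a / s | a s. a \<in> P [^]\<^bsub>ideals_set (ring_of_ints K)\<^esub> nat m
                       \<and> s \<in> carrier (ring_of_ints K) - P}
      else {x \<in> K. \<forall>y \<in> P [^]\<^bsub>ideals_set (ring_of_ints K)\<^esub> nat (- m). x * y \<in> local_ring K P})"

text \<open>The \<open>P\<close>-adic valuation on \<open>K\<close> is the largest \<open>m\<close> with \<open>x \<in> P\<^sup>m O\<^bsub>K,P\<^esub>\<close>; the supremum
  is \<open>\<infinity>\<close> exactly at \<open>0\<close>.\<close>

definition prime_valuation :: "real set \<Rightarrow> real set \<Rightarrow> real \<Rightarrow> ereal" where
  "prime_valuation K P x = (SUP m \<in> {m. x \<in> local_power K P m}. ereal (real_of_int m))"

definition cong_mod_prime :: "real set \<Rightarrow> real set \<Rightarrow> real \<Rightarrow> real \<Rightarrow> bool" where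
  "cong_mod_prime K P x y \<longleftrightarrow>
     x \<in> local_ring K P \<and> y \<in> local_ring K P \<and> x - y \<in> local_power K P 1"

definition residue_field :: "real set \<Rightarrow> real set \<Rightarrow> real set ring" where
  "residue_field K P = ring_of_ints K Quot P"

definition residue_class :: "real set \<Rightarrow> real set \<Rightarrow> real \<Rightarrow> real set" where
  "residue_class K P a = P +>\<^bsub>ring_of_ints K\<^esub> a"

text \<open>Reduction of a \<open>P\<close>-integral element: the class of \<open>a\<close> divided by the (nonzero) class
  of \<open>s\<close> when \<open>x = a / s\<close> with \<open>s \<notin> P\<close>.\<close>

definition reduction :: "real set \<Rightarrow> real set \<Rightarrow> real \<Rightarrow> real set" where
  "reduction K P x =
     (THE c. c \<in> carrier (residue_field K P) \<and>
        (\<exists>a \<in> carrier (ring_of_ints K). \<exists>s \<in> carrier (ring_of_ints K) - P.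
           x = a / s \<and> c \<otimes>\<^bsub>residue_field K P\<^esub> residue_class K P s = residue_class K P a))"


section \<open>The \<open>p\<close>-adic integers\<close>

text \<open>\<open>\<int>\<^sub>p\<close> as the inverse limit of the rings \<open>\<int>/p\<^sup>n\<close>, the latter represented by
  \<open>{0..<p\<^sup>n}\<close>, with the inverse limit topology.\<close>

definition padic_ring :: "nat \<Rightarrow> (nat \<Rightarrow> int) ring" where
  "padic_ring p =
     \<lparr> carrier = {z. \<forall>n. z n \<in> {0..<int p ^ n} \<and> z (Suc n) mod int p ^ n = z n},
       monoid.mult = (\<lambda>x y n. (x n * y n) mod int p ^ n),
       one = (\<lambda>n. 1 mod int p ^ n),
       ring.zero = (\<lambda>n. 0),
       add = (\<lambda>x y n. (x n + y n) mod int p ^ n) \<rparr>"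

definition padic_of_int :: "nat \<Rightarrow> int \<Rightarrow> (nat \<Rightarrow> int)" where
  "padic_of_int p m = (\<lambda>n. m mod int p ^ n)"

definition padic_topology :: "nat \<Rightarrow> (nat \<Rightarrow> int) topology" where
  "padic_topology p =
     subtopology (product_topology (\<lambda>n. discrete_topology {0..<int p ^ n}) UNIV)
       (carrier (padic_ring p))"

definition padic_lim :: "nat \<Rightarrow> (nat \<Rightarrow> (nat \<Rightarrow> int)) \<Rightarrow> (nat \<Rightarrow> int)" where
  "padic_lim p u = (THE z. limitin (padic_topology p) u z sequentially)"

definition padic_principal_units :: "nat \<Rightarrow> (nat \<Rightarrow> int) set" where
  "padic_principal_units p =
     {\<one>\<^bsub>padic_ring p\<^esub> \<oplus>\<^bsub>padic_ring p\<^esub> (padic_of_int p (int p) \<otimes>\<^bsub>padic_ring p\<^esub> w) | w.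
        w \<in> carrier (padic_ring p)}"

definition kappa_padic :: "nat \<Rightarrow> nat \<Rightarrow> (nat \<Rightarrow> int)" where
  "kappa_padic d p = padic_lim p (\<lambda>k. padic_of_int p (int (num_indep d (p ^ Suc k))))"

text \<open>For \<open>P\<close> above \<open>p\<close>, the map \<open>\<int>\<^sub>p \<rightarrow> F\<^sub>p \<subseteq> O\<^sub>K/P\<close>: the component \<open>z 1 \<in> {0..<p}\<close>
  represents the image of \<open>z\<close> in \<open>F\<^sub>p\<close>.\<close>

definition padic_reduction :: "real set \<Rightarrow> real set \<Rightarrow> (nat \<Rightarrow> int) \<Rightarrow> real set" where
  "padic_reduction K P z = residue_class K P (of_int (z 1))"

end

theory Submission
  imports Defs
begin

text \<open>
  For \<open>n \<ge> 2\<close>, independent sets of \<open>T\<^sub>d(n)\<close> are the \<open>n\<close>-periodic independent subsets of the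
  grid \<open>\<int>\<^sup>d\<close>. Among the \<open>p\<^bsup>m+1\<^esup>\<close>-periodic ones, consider those that are \<open>p\<^sup>m\<close>-periodic in the
  directions before \<open>i\<close> but not in direction \<open>i\<close>: translations along \<open>e\<^sub>i\<close> act freely on them
  through \<open>\<int>/p\<^bsup>m+1\<^esup>\<close>, so their number is divisible by \<open>p\<^bsup>m+1\<^esup>\<close>. Hence the counts for \<open>p\<^bsup>m+1\<^esup>\<close> and
  \<open>p\<^sup>m\<close> agree modulo \<open>p\<^bsup>m+1\<^esup>\<close>, and all of them are 1 modulo \<open>p\<close>, because only the empty set is
  both 1-periodic and independent.

  If \<open>p\<^sup>k \<in> E\<^sub>d\<close>, then \<open>\<kappa>\<close> is a root of \<open>x\<^bsup>N\<^esup> - a\<close> with \<open>N = p\<^bsup>kd\<^esup>\<close> and \<open>a\<close> an integer, so it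
  is an algebraic integer with \<open>\<kappa>\<^bsup>N\<^esup> = 1\<close> modulo \<open>P\<close>; since \<open>N\<close> is a power of \<open>p\<close>, injectivity
  of Frobenius on \<open>O\<^sub>K/P\<close> gives \<open>\<kappa> = 1\<close> modulo \<open>P\<close>.
\<close>

subsection \<open>Periodic independent sets of the grid\<close>

text \<open>Coordinates stay integers rather than residues, so that \<int> acts along each axis and
  the sets of all periods live on one space.\<close>

definition shift :: "nat \<Rightarrow> int \<Rightarrow> (nat \<Rightarrow> int) \<Rightarrow> nat \<Rightarrow> int" where
  "shift i a x = x(i := x i + a)"

lemma shift_0 [simp]: "shift i 0 = id"
  by (simp add: shift_def fun_eq_iff)

lemma shift_shift: "shift i a (shift i b x) = shift i (a + b) x"
  by (simp add: shift_def fun_eq_iff)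

lemma shift_commute: "shift i a (shift j b x) = shift j b (shift i a x)"
  by (simp add: shift_def fun_eq_iff)

lemma image_shift_add: "shift i (a + b) ` A = shift i a ` shift i b ` A"
  by (simp add: image_image shift_shift)

lemma image_shift_commute: "shift i a ` shift j b ` A = shift j b ` shift i a ` A"
  by (simp add: image_image shift_commute)

lemma inj_shift: "inj (shift i a)"
  by (rule inj_on_inverseI[where g = "shift i (- a)"]) (simp add: shift_shift)

lemma shift_in_extensional: "i < d \<Longrightarrow> x \<in> extensional {..<d} \<Longrightarrow> shift i a x \<in> extensional {..<d}"
  by (auto simp: shift_def extensional_def)

section \<open>Orbit sizes for actions of \<int> with prime power period\<close>

text \<open>Stabilisers are subgroups of \<int>. Nonnegative multiples go by induction; a negative
  one is cancelled against the opposite positive one.\<close>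

lemma int_action_fixed_multiple:
  fixes act :: "int \<Rightarrow> 'a \<Rightarrow> 'a"
  assumes zero: "\<And>x. act 0 x = x" and add: "\<And>a b x. act (a + b) x = act a (act b x)"
    and fixed: "act a x = x"
  shows "act (a * t) x = x"
proof -
  have pos: "act (a * int n) x = x" for n
  proof (induction n)
    case (Suc n)
    have "act (a * int (Suc n)) x = act (a * int n) (act a x)"
      by (simp add: add[symmetric] algebra_simps)
    then show ?case using Suc fixed by simp
  qed (simp add: zero)
  show ?thesis
  proof (cases "t \<ge> 0")
    case True
    then show ?thesis using pos[of "nat t"] by simp
  next
    case False
    have "act (a * t) x = act (a * t) (act (a * int (nat (- t))) x)"
      by (simp only: pos)
    also have "\<dots> = act (a * t + a * int (nat (- t))) x" by (simp add: add)
    also have "a * t + a * int (nat (- t)) = 0" using False by simp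
    finally show ?thesis using zero by simp
  qed
qed

text \<open>Every stabiliser contains \<open>p ^ Suc m\<close> but not \<open>p ^ m\<close>, so it
  is generated by \<open>p ^ Suc m\<close>. Hence all orbits have exactly \<open>p ^ Suc m\<close>
  elements, and they partition \<open>Y\<close>.\<close>

lemma prime_power_dvd_card:
  fixes act :: "int \<Rightarrow> 'a \<Rightarrow> 'a" and p m :: nat
  assumes p: "Factorial_Ring.prime p" and fin: "finite Y"
    and zero: "\<And>x. act 0 x = x" and add: "\<And>a b x. act (a + b) x = act a (act b x)"
    and closed: "\<And>a x. x \<in> Y \<Longrightarrow> act a x \<in> Y"
    and period: "\<And>x. x \<in> Y \<Longrightarrow> act (int (p ^ Suc m)) x = x"
    and free: "\<And>x. x \<in> Y \<Longrightarrow> act (int (p ^ m)) x \<noteq> x"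
  shows "p ^ Suc m dvd card Y"
proof -
  define r where "r = {(x, y). x \<in> Y \<and> (\<exists>a. y = act a x)}"
  define N where "N = int (p ^ Suc m)"
  have Npos: "N > 0" using p by (simp add: N_def prime_gt_0_nat)
  note mult = int_action_fixed_multiple[of act, OF zero add]
  have inverse: "act (- a) (act a x) = x" for a x
    by (simp add: add[symmetric] zero)
  have stab: "N dvd a" if x: "x \<in> Y" and a: "act a x = x" for a x
  proof -
    \<comment> \<open>Bezout puts the gcd of \<open>a\<close> and \<open>N\<close> into the
      stabiliser. It is some \<open>p ^ j\<close>, and \<open>j \<le> m\<close> would put
      \<open>p ^ m\<close> there too, against \<open>free\<close>.\<close>
    obtain u v where uv: "u * a + v * N = gcd a N" using bezout_int by blast
    have "act (a * u) (act (N * v) x) = x"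
      using mult[OF a] mult[OF period[OF x]] by (simp add: N_def)
    then have g: "act (gcd a N) x = x"
      by (simp add: add[symmetric] uv[symmetric] mult.commute)
    have "nat (gcd a N) dvd p ^ Suc m"
      by (simp add: nat_dvd_iff N_def del: power_Suc of_nat_power)
    then obtain j where j: "j \<le> Suc m" "nat (gcd a N) = p ^ j"
      using divides_primepow_nat[OF p] by blast
    then have gj: "gcd a N = int (p ^ j)" by (metis gcd_ge_0_int nat_0_le)
    show ?thesis
    proof (cases "j = Suc m")
      case True
      then show ?thesis using gj N_def by (metis gcd_dvd1)
    next
      case False
      then have "p ^ j dvd p ^ m" using j by (simp add: le_imp_power_dvd)
      then obtain t where "p ^ m = p ^ j * t" by blast
      then have "int (p ^ m) = gcd a N * int t" using gj by simp
      then have "act (int (p ^ m)) x = x" using mult[OF g] by simp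
      then show ?thesis using free[OF x] by simp
    qed
  qed
  have "p ^ Suc m dvd card c" if "c \<in> Y // r" for c
  proof -
    from that obtain x where x: "x \<in> Y" and c: "c = r `` {x}" by (auto elim: quotientE)
    \<comment> \<open>The orbit is parametrised by the residues modulo \<open>N\<close>:
      \<open>period\<close> gives surjectivity, \<open>stab\<close> injectivity.\<close>
    have "c = (\<lambda>a. act a x) ` {0..<N}"
    proof -
      have "act a x = act (a mod N) x" for a
      proof -
        have "act a x = act (a mod N) (act (N * (a div N)) x)"
          by (simp add: add[symmetric])
        then show ?thesis using mult[OF period[OF x]] by (simp add: N_def)
      qed
      moreover have "a mod N \<in> {0..<N}" for a using Npos by simp
      ultimately show ?thesis using x unfolding c r_def by blast
    qed
    moreover have "inj_on (\<lambda>a. act a x) {0..<N}"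
    proof (rule inj_onI)
      fix a b assume ab: "a \<in> {0..<N}" "b \<in> {0..<N}" and eq: "act a x = act b x"
      have "act (- b + a) x = x" using inverse[of b x] by (simp only: add eq)
      then have "N dvd a - b" using stab[OF x] by (simp add: algebra_simps)
      then have "a mod N = b mod N" by (simp add: mod_eq_dvd_iff)
      then show "a = b" using ab by simp
    qed
    ultimately have "card c = nat N" by (simp add: card_image)
    then show ?thesis by (simp only: N_def nat_int dvd_refl)
  qed
  moreover have "equiv Y r"
  proof (rule equivI)
    show "r \<subseteq> Y \<times> Y" using closed by (auto simp: r_def)
    show "refl_on Y r" using zero by (auto simp: r_def refl_on_def intro!: exI[of _ 0])
    show "sym r"
      using closed inverse by (auto simp: r_def intro!: symI) metis
    show "trans r"
      by (rule transI) (auto simp: r_def add[symmetric])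
  qed
  ultimately show ?thesis
    using fin equiv_imp_dvd_card by blast
qed

text \<open>For \<open>n = 1\<close> this is not the same as independent sets of \<open>T\<^sub>d(1)\<close>, which has no loops: there
  the singleton vertex set is independent, whereas the full grid is not.\<close>

definition periodic_indep :: "nat \<Rightarrow> nat \<Rightarrow> (nat \<Rightarrow> int) set set" where
  "periodic_indep d n = {A. A \<subseteq> extensional {..<d} \<and> (\<forall>i<d. shift i (int n) ` A = A) \<and>
     (\<forall>i<d. \<forall>x\<in>A. shift i 1 x \<notin> A)}"

lemma image_shift_multiple:
  assumes "shift i a ` A = A"
  shows "shift i (a * t) ` A = A"
  by (rule int_action_fixed_multiple[of "\<lambda>a. (`) (shift i a)"])
    (auto simp: image_shift_add assms)

text \<open>The coordinates of \<open>x\<close> are exchanged for those of \<open>y\<close> one at a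
  time; each exchange is a translation along one axis by a multiple of \<open>n\<close>.\<close>

lemma periodic_mem_cong:
  assumes "A \<subseteq> extensional {..<d}" "\<forall>i<d. shift i (int n) ` A = A"
    and x: "x \<in> A" and y: "y \<in> extensional {..<d}"
    and cong: "\<And>j. j < d \<Longrightarrow> x j mod int n = y j mod int n"
  shows "y \<in> A"
proof -
  have "(\<lambda>j. if j < m then y j else x j) \<in> A" if "m \<le> d" for m
    using that
  proof (induction m)
    case 0
    then show ?case using x by simp
  next
    case (Suc m)
    define z where "z = (\<lambda>j. if j < m then y j else x j)"
    have z: "z \<in> A" using Suc by (simp add: z_def)
    have "int n dvd y m - x m" using cong[of m] Suc.prems by (metis Suc_le_lessD mod_eq_dvd_iff)
    then obtain t where t: "y m - x m = int n * t" by blast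
    have "shift m (int n * t) z \<in> A"
      using image_shift_multiple[of m "int n" A t] assms(2) Suc.prems z by auto
    moreover have "shift m (int n * t) z = (\<lambda>j. if j < Suc m then y j else x j)"
      using t by (auto simp: shift_def z_def fun_eq_iff less_Suc_eq)
    ultimately show ?case by simp
  qed
  from this[of d] have "(\<lambda>j. if j < d then y j else x j) \<in> A" by simp
  moreover have "(\<lambda>j. if j < d then y j else x j) = y"
    using x y assms(1) by (auto simp: fun_eq_iff extensional_def)
  ultimately show ?thesis by simp
qed

section \<open>The fundamental box and the comparison with the torus\<close>

text \<open>The projection from the grid to the torus, whose vertices are the points of the box with
  side \<open>{0..<int n}\<close>.\<close>

definition residue_point :: "nat \<Rightarrow> nat \<Rightarrow> (nat \<Rightarrow> int) \<Rightarrow> nat \<Rightarrow> int" where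
  "residue_point d n x = (\<lambda>j\<in>{..<d}. x j mod int n)"

lemma residue_point_in_box: "n \<ge> 1 \<Longrightarrow> residue_point d n x \<in> {..<d} \<rightarrow>\<^sub>E {0..<int n}"
  by (auto simp: residue_point_def)

lemma residue_point_box: "x \<in> {..<d} \<rightarrow>\<^sub>E {0..<int n} \<Longrightarrow> residue_point d n x = x"
  by (auto simp: residue_point_def fun_eq_iff PiE_def Pi_def extensional_def)

lemma residue_point_shift_residue:
  "residue_point d n (shift i a (residue_point d n x)) = residue_point d n (shift i a x)"
  by (auto simp: residue_point_def shift_def fun_eq_iff mod_simps)

lemma residue_point_in_iff:
  assumes "A \<in> periodic_indep d n" "n \<ge> 1" "x \<in> extensional {..<d}"
  shows "residue_point d n x \<in> A \<longleftrightarrow> x \<in> A"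
  using assms periodic_mem_cong[of A d n x "residue_point d n x"]
    periodic_mem_cong[of A d n "residue_point d n x" x]
  by (auto simp: periodic_indep_def residue_point_def)

text \<open>Membership of a point is decided by its representative in the box. This gives finiteness
  and, later, the count.\<close>

lemma inj_on_inter_box: 
  assumes "n \<ge> 1"
  shows "inj_on (\<lambda>A. A \<inter> ({..<d} \<rightarrow>\<^sub>E {0..<int n})) (periodic_indep d n)"
proof (rule inj_onI)
  fix A B :: "(nat \<Rightarrow> int) set"
  assume A: "A \<in> periodic_indep d n" and B: "B \<in> periodic_indep d n"
    and eq: "A \<inter> ({..<d} \<rightarrow>\<^sub>E {0..<int n}) = B \<inter> ({..<d} \<rightarrow>\<^sub>E {0..<int n})"
  have "x \<in> A \<longleftrightarrow> x \<in> B" if "x \<in> extensional {..<d}" for x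
    using residue_point_in_iff[OF A assms that] residue_point_in_iff[OF B assms that]
      residue_point_in_box[OF assms] eq by blast
  moreover have "A \<subseteq> extensional {..<d}" "B \<subseteq> extensional {..<d}"
    using A B by (auto simp: periodic_indep_def)
  ultimately show "A = B" by blast
qed

lemma finite_periodic_indep:
  assumes "n \<ge> 1"
  shows "finite (periodic_indep d n)"
proof (rule inj_on_finite[OF inj_on_inter_box[OF assms]])
  show "(\<lambda>A. A \<inter> ({..<d} \<rightarrow>\<^sub>E {0..<int n})) ` periodic_indep d n \<subseteq> Pow ({..<d} \<rightarrow>\<^sub>E {0..<int n})"
    by auto
  show "finite (Pow ({..<d} \<rightarrow>\<^sub>E {0..<int n}))"
    by (simp add: finite_PiE)
qed

text \<open>An edge in direction \<open>- 1\<close> is an edge in direction \<open>1\<close> read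
  from its other end, so forward neighbours suffice to test independence.\<close>

lemma torus_independent_sets:
  assumes n: "n \<ge> 2"
  shows "independent_sets (carrier (torus_group d n))
           (cayley_edges (torus_group d n) (torus_generators d n)) =
         {A. A \<subseteq> {..<d} \<rightarrow>\<^sub>E {0..<int n} \<and> (\<forall>i<d. \<forall>x\<in>A. residue_point d n (shift i 1 x) \<notin> A)}"
    (is "?L = ?R")
proof -
  let ?G = "torus_group d n"
  let ?box = "{..<d} \<rightarrow>\<^sub>E {0..<int n}"
  have carr: "carrier ?G = ?box"
    using n by (simp add: torus_group_def carrier_integer_mod_group)
  have basis: "basis_vector d n i \<in> carrier ?G" for i
    using n by (auto simp: carr basis_vector_def)
  have inv: "inv\<^bsub>?G\<^esub> basis_vector d n i = (\<lambda>j\<in>{..<d}. (- basis_vector d n i j) mod int n)" for i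
    using basis[of i] unfolding torus_group_def
    by (subst inv_product_group) (auto simp: fun_eq_iff PiE_def Pi_def)
  have ne: "basis_vector d n i \<noteq> \<one>\<^bsub>?G\<^esub>" "inv\<^bsub>?G\<^esub> basis_vector d n i \<noteq> \<one>\<^bsub>?G\<^esub>" if "i < d" for i
  proof -
    \<comment> \<open>Both inequalities are read off in coordinate \<open>i\<close>, where 1 and -1
      are nonzero modulo \<open>n\<close> because \<open>n \<ge> 2\<close>. So deleting the identity
      from the generators deletes nothing.\<close>
    have "basis_vector d n i i \<noteq> \<one>\<^bsub>?G\<^esub> i"
      using that n by (simp add: basis_vector_def torus_group_def)
    then show "basis_vector d n i \<noteq> \<one>\<^bsub>?G\<^esub>" by metis
    have "(- 1) mod int n \<noteq> 0" using n by (simp add: zmod_minus1)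
    then have "(inv\<^bsub>?G\<^esub> basis_vector d n i) i \<noteq> \<one>\<^bsub>?G\<^esub> i"
      unfolding inv using that n by (simp add: basis_vector_def torus_group_def mod_minus_eq)
    then show "inv\<^bsub>?G\<^esub> basis_vector d n i \<noteq> \<one>\<^bsub>?G\<^esub>" by metis
  qed
  have gens: "torus_generators d n =
      (\<Union>i<d. {basis_vector d n i, inv\<^bsub>?G\<^esub> (basis_vector d n i)})"
    using ne by (force simp: torus_generators_def)
  have plus: "x \<otimes>\<^bsub>?G\<^esub> basis_vector d n i = residue_point d n (shift i 1 x)" if "i < d" for x i
    using that by (auto simp: torus_group_def basis_vector_def residue_point_def shift_def
        fun_eq_iff mod_simps)
  have minus: "x \<otimes>\<^bsub>?G\<^esub> inv\<^bsub>?G\<^esub> basis_vector d n i = residue_point d n (shift i (- 1) x)"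
    if "i < d" for x i
    unfolding inv using that
    by (auto simp: torus_group_def basis_vector_def residue_point_def shift_def
        fun_eq_iff mod_simps)
  have edges: "cayley_edges ?G (torus_generators d n) =
      {{x, residue_point d n (shift i a x)} | x i a. x \<in> ?box \<and> i < d \<and> (a = 1 \<or> a = - 1)}"
  proof (intro equalityI subsetI)
    fix e assume "e \<in> cayley_edges ?G (torus_generators d n)"
    then obtain x s where x: "x \<in> ?box" and s: "s \<in> torus_generators d n"
      and e: "e = {x, x \<otimes>\<^bsub>?G\<^esub> s}"
      unfolding cayley_edges_def carr by blast
    obtain i where i: "i < d" "s = basis_vector d n i \<or> s = inv\<^bsub>?G\<^esub> basis_vector d n i"
      using s unfolding gens by blast
    have "\<exists>a. (a = 1 \<or> a = - 1) \<and> x \<otimes>\<^bsub>?G\<^esub> s = residue_point d n (shift i a x)"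
      using i(2)
    proof
      assume "s = basis_vector d n i"
      then show ?thesis using plus[OF i(1), of x] by (intro exI[of _ 1]) simp
    next
      assume "s = inv\<^bsub>?G\<^esub> basis_vector d n i"
      then show ?thesis using minus[OF i(1), of x] by (intro exI[of _ "- 1"]) simp
    qed
    then obtain a where a: "a = 1 \<or> a = - 1"
      and xs: "x \<otimes>\<^bsub>?G\<^esub> s = residue_point d n (shift i a x)" by metis
    show "e \<in> {{x, residue_point d n (shift i a x)} | x i a.
        x \<in> ?box \<and> i < d \<and> (a = 1 \<or> a = - 1)}"
      unfolding mem_Collect_eq
      by (intro exI[of _ x] exI[of _ i] exI[of _ a] conjI x i(1) a) (simp only: e xs)
  next
    fix e assume "e \<in> {{x, residue_point d n (shift i a x)} | x i a.
        x \<in> ?box \<and> i < d \<and> (a = 1 \<or> a = - 1)}"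
    then obtain x i a where x: "x \<in> ?box" and i: "i < d" and a: "a = 1 \<or> a = - 1"
      and e: "e = {x, residue_point d n (shift i a x)}" by blast
    define s where "s = (if a = 1 then basis_vector d n i else inv\<^bsub>?G\<^esub> basis_vector d n i)"
    have "s \<in> torus_generators d n" unfolding gens s_def using i by auto
    moreover have "e = {x, x \<otimes>\<^bsub>?G\<^esub> s}"
      using a plus[OF i] minus[OF i] by (auto simp: e s_def)
    ultimately show "e \<in> cayley_edges ?G (torus_generators d n)"
      unfolding cayley_edges_def carr using x by blast
  qed
  have shift_back: "residue_point d n (shift i 1 (residue_point d n (shift i (- 1) x))) = x"
    if "x \<in> ?box" for x i
    by (simp add: residue_point_shift_residue shift_shift residue_point_box[OF that])
  show ?thesis
  proof (intro equalityI subsetI)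
    fix A assume "A \<in> ?L"
    then have A: "A \<subseteq> ?box"
      and indep: "\<And>e. e \<in> cayley_edges ?G (torus_generators d n) \<Longrightarrow> \<not> e \<subseteq> A"
      unfolding independent_sets_def carr by auto
    have "residue_point d n (shift i 1 x) \<notin> A" if "i < d" "x \<in> A" for i x
    proof -
      have "{x, residue_point d n (shift i 1 x)} \<in> cayley_edges ?G (torus_generators d n)"
        unfolding edges using that A by blast
      then show ?thesis using indep that by blast
    qed
    then show "A \<in> ?R" using A by blast
  next
    fix A assume A: "A \<in> ?R"
    have "\<not> {x, residue_point d n (shift i a x)} \<subseteq> A"
      if "x \<in> ?box" "i < d" "a = 1 \<or> a = - 1" for x i a
    proof
      assume sub: "{x, residue_point d n (shift i a x)} \<subseteq> A"
      show False
      proof (cases "a = 1")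
        case True
        then show ?thesis using sub that A by blast
      next
        case False
        then have y: "residue_point d n (shift i (- 1) x) \<in> A" using sub that by simp
        have "residue_point d n (shift i 1 (residue_point d n (shift i (- 1) x))) \<in> A"
          unfolding shift_back[OF that(1)] using sub by simp
        then show ?thesis using y that A by blast
      qed
    qed
    then have "\<not> e \<subseteq> A" if "e \<in> cayley_edges ?G (torus_generators d n)" for e
      using that unfolding edges by auto
    then show "A \<in> ?L"
      unfolding independent_sets_def carr using A by auto
  qed
qed

text \<open>Intersection with the box is a bijection onto the independent sets of the torus; its
  inverse takes preimages under \<open>residue_point\<close>.\<close>

lemma num_indep_eq_card_periodic:
  assumes n: "n \<ge> 2"
  shows "num_indep d n = card (periodic_indep d n)"
proof -
  let ?box = "{..<d} \<rightarrow>\<^sub>E {0..<int n}"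
  let ?S = "{A. A \<subseteq> ?box \<and> (\<forall>i<d. \<forall>x\<in>A. residue_point d n (shift i 1 x) \<notin> A)}"
  have n1: "n \<ge> 1" using n by simp
  have "(\<lambda>A. A \<inter> ?box) ` periodic_indep d n = ?S"
  proof (intro equalityI subsetI)
    fix B assume "B \<in> (\<lambda>A. A \<inter> ?box) ` periodic_indep d n"
    then obtain A where A: "A \<in> periodic_indep d n" and B: "B = A \<inter> ?box" by blast
    have "residue_point d n (shift i 1 x) \<notin> A" if "i < d" "x \<in> A" for i x
      using that A residue_point_in_iff[OF A n1, of "shift i 1 x"] shift_in_extensional[of i d x 1]
      by (auto simp: periodic_indep_def)
    then show "B \<in> ?S" using B by blast
  next
    fix B assume B: "B \<in> ?S"
    define A where "A = {x \<in> extensional {..<d}. residue_point d n x \<in> B}"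
    have sub: "shift i (int n * s) x \<in> A" if "i < d" "x \<in> A" for i x s
    proof -
      have "residue_point d n (shift i (int n * s) x) = residue_point d n x"
        by (auto simp: residue_point_def shift_def fun_eq_iff)
      then show ?thesis using that by (simp add: A_def shift_in_extensional)
    qed
    have "shift i (int n) ` A = A" if "i < d" for i
    proof (intro equalityI subsetI)
      fix x assume "x \<in> shift i (int n) ` A"
      then show "x \<in> A" using sub[OF that, of _ 1] by auto
    next
      fix x assume "x \<in> A"
      then have "shift i (- int n) x \<in> A" using sub[OF that, of _ "- 1"] by simp
      then show "x \<in> shift i (int n) ` A"
        by (rule rev_image_eqI) (simp add: shift_shift)
    qed
    moreover have "shift i 1 x \<notin> A" if "i < d" "x \<in> A" for i x
    proof
      assume "shift i 1 x \<in> A"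
      then have "residue_point d n (shift i 1 (residue_point d n x)) \<in> B"
        by (simp add: A_def residue_point_shift_residue)
      then show False using B that by (auto simp: A_def)
    qed
    ultimately have "A \<in> periodic_indep d n"
      by (auto simp: periodic_indep_def A_def)
    moreover have "A \<inter> ?box = B"
    proof (intro equalityI subsetI)
      fix x assume "x \<in> A \<inter> ?box"
      then show "x \<in> B" using residue_point_box[of x d n] by (simp add: A_def)
    next
      fix x assume x: "x \<in> B"
      then have "x \<in> ?box" using B by blast
      then show "x \<in> A \<inter> ?box"
        using x residue_point_box[of x d n] by (simp add: A_def PiE_iff)
    qed
    ultimately show "B \<in> (\<lambda>A. A \<inter> ?box) ` periodic_indep d n" by blast
  qed
  then show ?thesis
    unfolding num_indep_def torus_independent_sets[OF n]
    using card_image[OF inj_on_inter_box[OF n1]] by metis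
qed

section \<open>Congruences between the counts at consecutive powers of \<open>p\<close>\<close>

text \<open>Translations commute with one another and are injective, so they preserve periods and
  independence; \<open>i < d\<close> keeps the points extensional.\<close>

lemma image_shift_periodic_indep:
  assumes A: "A \<in> periodic_indep d n" and i: "i < d"
  shows "shift i a ` A \<in> periodic_indep d n"
proof -
  have "shift j 1 (shift i a x) \<notin> shift i a ` A" if "j < d" "x \<in> A" for j x
    using A that inj_shift[of i a]
    by (auto simp: periodic_indep_def shift_commute[of j] inj_image_mem_iff)
  moreover have "shift j (int n) ` shift i a ` A = shift i a ` A" if "j < d" for j
    using A that image_shift_commute[of j "int n" i a A] by (simp add: periodic_indep_def)
  moreover have "shift i a ` A \<subseteq> extensional {..<d}"
    using A i by (auto simp: periodic_indep_def intro!: shift_in_extensional)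
  ultimately show ?thesis by (auto simp: periodic_indep_def)
qed

lemma card_periodic_indep_cong:
  assumes p: "Factorial_Ring.prime p"
  shows "[card (periodic_indep d (p ^ Suc m)) = card (periodic_indep d (p ^ m))] (mod p ^ Suc m)"
proof -
  \<comment> \<open>\<open>F\<close> imposes the finer period one direction at a time, from the
    \<open>p ^ Suc m\<close>-periodic sets at 0 down to the \<open>p ^ m\<close>-periodic ones at
    \<open>d\<close>.\<close>
  define F where "F i = {A \<in> periodic_indep d (p ^ Suc m). \<forall>j<i. shift j (int (p ^ m)) ` A = A}" for i
  have fin: "finite (periodic_indep d (p ^ Suc m))"
    using p by (intro finite_periodic_indep) (simp add: prime_gt_0_nat Suc_le_eq)
  have step: "[card (F i) = card (F (Suc i))] (mod p ^ Suc m)" if i: "i < d" for i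
  proof -
    \<comment> \<open>The layer lost in passing to \<open>F (Suc i)\<close>. Translations in the
      same direction \<open>i\<close> act on it: \<open>p ^ Suc m\<close> fixes each of its sets and
      \<open>p ^ m\<close> fixes none.\<close>
    define Y where "Y = {A \<in> F i. shift i (int (p ^ m)) ` A \<noteq> A}"
    have "p ^ Suc m dvd card Y"
    proof (rule prime_power_dvd_card[where act = "\<lambda>a. (`) (shift i a)", OF p])
      show "finite Y" using fin by (simp add: Y_def F_def)
    next
      fix a A assume A: "A \<in> Y"
      have "shift j (int (p ^ m)) ` shift i a ` A = shift i a ` A" if "j < i" for j
        using A that image_shift_commute[of j "int (p ^ m)" i a A] by (simp add: Y_def F_def)
      moreover have "shift i (int (p ^ m)) ` shift i a ` A \<noteq> shift i a ` A"
        using A unfolding image_shift_commute[of i "int (p ^ m)" i a A]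
        by (simp add: Y_def inj_image_eq_iff[OF inj_shift])
      ultimately show "shift i a ` A \<in> Y"
        using A image_shift_periodic_indep[OF _ i] by (simp add: Y_def F_def)
    next
      fix A assume "A \<in> Y"
      then show "shift i (int (p ^ Suc m)) ` A = A" "shift i (int (p ^ m)) ` A \<noteq> A"
        using i by (auto simp: Y_def F_def periodic_indep_def)
    qed (auto simp: image_shift_add)
    moreover have "F i = F (Suc i) \<union> Y" "F (Suc i) \<inter> Y = {}"
      by (auto simp: F_def Y_def less_Suc_eq)
    moreover have "finite (F (Suc i))" "finite Y"
      using fin by (auto simp: F_def Y_def)
    ultimately have "card (F i) = card (F (Suc i)) + card Y" "p ^ Suc m dvd card Y"
      by (simp_all add: card_Un_disjoint)
    then show ?thesis by (simp add: cong_def mod_add_eq[symmetric])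
  qed
  have total: "[card (F 0) = card (F i)] (mod p ^ Suc m)" if "i \<le> d" for i
    using that
  proof (induction i)
    case (Suc i)
    then show ?case using step[of i] by (meson Suc_le_lessD cong_trans less_imp_le)
  qed simp
  have F_0: "F 0 = periodic_indep d (p ^ Suc m)" by (simp add: F_def)
  have F_d: "F d = periodic_indep d (p ^ m)"
  proof -
    have "shift i (int (p ^ Suc m)) ` A = A" if "shift i (int (p ^ m)) ` A = A" for i A
      using image_shift_multiple[OF that, of "int p"] by (simp add: mult.commute)
    then show ?thesis unfolding F_def periodic_indep_def by (intro equalityI subsetI; simp)
  qed
  show ?thesis using total[of d] unfolding F_0 F_d by simp
qed

text \<open>A 1-periodic set containing a point contains its neighbours too;
  \<open>d \<ge> 1\<close> supplies a direction.\<close>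

lemma periodic_indep_1: "d \<ge> 1 \<Longrightarrow> periodic_indep d 1 = {{}}"
  by (force simp: periodic_indep_def)

text \<open>The tower is followed down to level 0. There the count of grid sets is 1, whereas the
  one-vertex torus has two independent sets.\<close>

lemma card_periodic_indep_cong_1:
  assumes "Factorial_Ring.prime p" "d \<ge> 1"
  shows "[card (periodic_indep d (p ^ m)) = 1] (mod p)"
proof (induction m)
  case 0
  then show ?case using periodic_indep_1[of d] assms by simp
next
  case (Suc m)
  have "[card (periodic_indep d (p ^ Suc m)) = card (periodic_indep d (p ^ m))] (mod p)"
    using card_periodic_indep_cong[OF assms(1), of d m] cong_dvd_modulus_nat
    by (metis dvd_triv_left power_Suc)
  then show ?case using Suc cong_trans by blast
qed

subsection \<open>Limits of p-adic congruence towers\<close>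

text \<open>A subspace of a product of discrete spaces is Hausdorff, so the description in
  \<open>padic_lim\<close> has a unique solution.\<close>

lemma padic_lim_eqI:
  assumes "limitin (padic_topology p) u z sequentially"
  shows "padic_lim p u = z"
proof -
  have "Hausdorff_space (padic_topology p)"
    unfolding padic_topology_def
    by (intro Hausdorff_space_subtopology) (simp add: Hausdorff_space_product_topology)
  then show ?thesis
    unfolding padic_lim_def using assms
    by (intro the_equality) (auto dest: limitin_Hausdorff_unique[OF _ assms trivial_limit_sequentially])
qed

lemma cong_tower:
  fixes c :: "nat \<Rightarrow> int"
  assumes "\<And>k. [c (Suc k) = c k] (mod int p ^ Suc k)" and "n \<le> k"
  shows "[c k = c n] (mod int p ^ n)"
  using \<open>n \<le> k\<close>
proof (induction k rule: dec_induct)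
  case (step k)
  have "[c (Suc k) = c k] (mod int p ^ n)"
    using cong_dvd_modulus[OF assms(1) le_imp_power_dvd] step.hyps by simp
  then show ?case using step.IH cong_trans by blast
qed simp

text \<open>Each component of the sequence is eventually constant, which is convergence in a
  discrete factor. The index \<open>Suc k\<close> matches \<open>kappa_padic\<close>, whose sequence
  starts at exponent 1.\<close>

lemma padic_lim_cong_tower:
  fixes c :: "nat \<Rightarrow> int"
  assumes c: "\<And>k. [c (Suc k) = c k] (mod int p ^ Suc k)" and p: "p > 0"
  shows "(\<lambda>n. c n mod int p ^ n) \<in> carrier (padic_ring p)"
    and "padic_lim p (\<lambda>k. padic_of_int p (c (Suc k))) = (\<lambda>n. c n mod int p ^ n)"
proof -
  define z where "z = (\<lambda>n. c n mod int p ^ n)"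
  have in_carrier: "padic_of_int p m \<in> carrier (padic_ring p)" for m
    using p by (auto simp: padic_of_int_def padic_ring_def mod_mod_cancel)
  show z: "z \<in> carrier (padic_ring p)"
    using p cong_dvd_modulus[OF c, of "int p ^ n" for n]
    by (auto simp: z_def padic_ring_def mod_mod_cancel cong_def)
  have ev: "\<forall>\<^sub>F k in sequentially. padic_of_int p (c (Suc k)) n = z n" for n
    using eventually_ge_at_top[of n]
  proof eventually_elim
    case (elim k)
    then show ?case
      using cong_tower[of c p n "Suc k", OF c] by (simp add: padic_of_int_def z_def cong_def)
  qed
  have "limitin (discrete_topology {0..<int p ^ n})
      (\<lambda>k. padic_of_int p (c (Suc k)) n) (z n) sequentially" for n
    unfolding limitin_def
  proof (intro conjI allI impI)
    show "z n \<in> topspace (discrete_topology {0..<int p ^ n})" using p by (simp add: z_def)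
    fix U assume "openin (discrete_topology {0..<int p ^ n}) U \<and> z n \<in> U"
    then show "\<forall>\<^sub>F k in sequentially. padic_of_int p (c (Suc k)) n \<in> U"
      by (intro eventually_mono[OF ev[of n]]) simp
  qed
  moreover have "padic_of_int p m n \<in> {0..<int p ^ n}" for m n
    using p by (simp add: padic_of_int_def)
  ultimately have "limitin (padic_topology p) (\<lambda>k. padic_of_int p (c (Suc k))) z sequentially"
    using z in_carrier unfolding padic_topology_def limitin_subtopology limitin_componentwise
    by (auto simp: PiE_UNIV_domain)
  then show "padic_lim p (\<lambda>k. padic_of_int p (c (Suc k))) = z"
    by (rule padic_lim_eqI)
qed

text \<open>All components from the first on are 1 modulo \<open>p\<close>; subtracting 1 and
  dividing by \<open>p\<close> gives the cofactor \<open>w\<close>.\<close>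

lemma padic_principal_unitsI:
  assumes z: "z \<in> carrier (padic_ring p)" and p: "p > 1" and z1: "z 1 = 1"
  shows "z \<in> padic_principal_units p"
proof -
  let ?P = "int p"
  have step: "z (Suc n) mod ?P ^ n = z n" and range: "0 \<le> z n" "z n < ?P ^ n" for n
    using z by (auto simp: padic_ring_def)
  have one: "\<exists>t. z (Suc n) = 1 + ?P * t" for n
  proof (induction n)
    case 0
    then show ?case using z1 by (intro exI[of _ 0]) simp
  next
    case (Suc n)
    then obtain t where t: "z (Suc n) = 1 + ?P * t" by blast
    have "z (Suc (Suc n)) = z (Suc n) + ?P ^ Suc n * (z (Suc (Suc n)) div ?P ^ Suc n)"
      using step[of "Suc n"] by (metis mod_mult_div_eq)
    then show ?case
      unfolding t by (intro exI[of _ "t + ?P ^ n * (z (Suc (Suc n)) div ?P ^ Suc n)"])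
        (simp add: algebra_simps)
  qed
  then obtain t where t: "\<And>n. z (Suc n) = 1 + ?P * t n" by metis
  \<comment> \<open>Division by \<open>p\<close> costs one power of \<open>p\<close> in precision,
    so component \<open>n\<close> of \<open>w\<close> comes from component \<open>Suc n\<close> of
    \<open>z\<close>.\<close>
  define w where "w n = t n mod ?P ^ n" for n
  have tmod: "t (Suc n) mod ?P ^ n = t n mod ?P ^ n" for n
  proof -
    have "[1 + ?P * t (Suc n) = 1 + ?P * t n] (mod ?P * ?P ^ n)"
      using step[of "Suc n"] t[of "Suc n"] t[of n] by (metis cong_def mod_mod_trivial power_Suc)
    then have "[?P * t (Suc n) = ?P * t n] (mod ?P * ?P ^ n)" by (simp add: cong_add_lcancel)
    then show ?thesis using p by (simp add: cong_def mult_mod_right[symmetric])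
  qed
  have "w \<in> carrier (padic_ring p)"
    using p tmod by (auto simp: w_def padic_ring_def mod_mod_cancel)
  moreover have "z = \<one>\<^bsub>padic_ring p\<^esub> \<oplus>\<^bsub>padic_ring p\<^esub>
      (padic_of_int p ?P \<otimes>\<^bsub>padic_ring p\<^esub> w)"
    using step t by (auto simp: padic_ring_def padic_of_int_def w_def fun_eq_iff mod_simps)
  ultimately show ?thesis unfolding padic_principal_units_def by blast
qed

subsection \<open>Reduction modulo a prime of a number field\<close>

text \<open>Only primality of \<open>P\<close> is built in; that \<open>P\<close> lies above
  \<open>p\<close> enters through explicit assumptions such as
  \<open>of_nat p \<in> P\<close>.\<close>

locale prime_of_ints = primeideal P "ring_of_ints K" for K P :: "real set"
begin

abbreviation OK :: "real set" where "OK \<equiv> carrier (ring_of_ints K)"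

lemma ops [simp]:
  "x \<otimes>\<^bsub>ring_of_ints K\<^esub> y = x * y" "x \<oplus>\<^bsub>ring_of_ints K\<^esub> y = x + y"
  "\<one>\<^bsub>ring_of_ints K\<^esub> = 1" "\<zero>\<^bsub>ring_of_ints K\<^esub> = 0"
  by (simp_all add: ring_of_ints_def ring_of_type_algebra_def)

lemma OK_iff: "x \<in> OK \<longleftrightarrow> x \<in> K \<and> algebraic_int x"
  by (simp add: ring_of_ints_def)

lemma OK_closed:
  "x \<in> OK \<Longrightarrow> y \<in> OK \<Longrightarrow> x + y \<in> OK" "x \<in> OK \<Longrightarrow> y \<in> OK \<Longrightarrow> x * y \<in> OK" "1 \<in> OK" "0 \<in> OK"
  using a_closed m_closed one_closed zero_closed by simp_all

lemma a_inv_OK: "x \<in> OK \<Longrightarrow> \<ominus>\<^bsub>ring_of_ints K\<^esub> x = - x"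
  using l_neg[of x] by simp

lemma OK_uminus: "x \<in> OK \<Longrightarrow> - x \<in> OK"
  using a_inv_closed[of x] by (simp add: a_inv_OK)

lemma OK_diff: "x \<in> OK \<Longrightarrow> y \<in> OK \<Longrightarrow> x - y \<in> OK"
  using OK_closed(1)[OF _ OK_uminus, of x y] by simp

lemma OK_power: "x \<in> OK \<Longrightarrow> x ^ n \<in> OK"
  by (induction n) (auto intro: OK_closed)

lemma OK_of_nat: "of_nat n \<in> OK"
  by (induction n) (auto intro: OK_closed)

lemma OK_sum: "(\<And>i. i \<in> I \<Longrightarrow> f i \<in> OK) \<Longrightarrow> sum f I \<in> OK"
  by (induction I rule: infinite_finite_induct) (auto intro: OK_closed)

lemma P_mult: "x \<in> P \<Longrightarrow> y \<in> OK \<Longrightarrow> x * y \<in> P"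
  using I_r_closed[of x y] by simp

lemma P_uminus: "x \<in> P \<Longrightarrow> - x \<in> P"
  using P_mult[of x "- 1"] OK_uminus[of 1] OK_closed by simp

lemma P_add: "x \<in> P \<Longrightarrow> y \<in> P \<Longrightarrow> x + y \<in> P"
  using additive_subgroup.a_closed[OF is_additive_subgroup] by simp

lemma P_diff: "x \<in> P \<Longrightarrow> y \<in> P \<Longrightarrow> x - y \<in> P"
  using P_add[OF _ P_uminus, of x y] by simp

lemma one_notin_P: "1 \<notin> P"
  using one_imp_carrier I_notcarr by auto

lemma P_prime: "x \<in> OK \<Longrightarrow> y \<in> OK \<Longrightarrow> x * y \<in> P \<Longrightarrow> x \<in> P \<or> y \<in> P"
  using I_prime[of x y] by simp

lemma P_power: "x \<in> OK \<Longrightarrow> x ^ n \<in> P \<Longrightarrow> x \<in> P"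
proof (induction n)
  case (Suc n)
  then show ?case using P_prime[of x "x ^ n"] OK_power by auto
qed (simp add: one_notin_P)

text \<open>Frobenius is injective on the domain \<open>O\<^sub>K/P\<close> of characteristic \<open>p\<close>.\<close>

lemma frobenius_one:
  fixes p :: nat
  assumes p: "Factorial_Ring.prime p" "of_nat p \<in> P" and x: "x \<in> OK" and xp: "x ^ p - 1 \<in> P"
  shows "x - 1 \<in> P"
proof -
  define y where "y = x - 1"
  have y: "y \<in> OK" using OK_diff[OF x OK_closed(3)] by (simp add: y_def)
  \<comment> \<open>\<open>of_nat p * w\<close> collects the middle terms of the binomial expansion
    of \<open>(y + 1) ^ p\<close>, whose coefficients are divisible by \<open>p\<close>.\<close>
  define w where "w = (\<Sum>k\<in>{1..<p}. of_nat ((p choose k) div p) * y ^ k)"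
  have w: "w \<in> OK"
    unfolding w_def by (intro OK_sum OK_closed OK_of_nat OK_power y)
  have "p > 0" using p by (simp add: prime_gt_0_nat)
  have "x ^ p = (\<Sum>k\<le>p. of_nat (p choose k) * y ^ k)"
    using binomial_ring[of y 1 p] by (simp add: y_def)
  also have "{..p} = {0} \<union> {1..<p} \<union> {p}" using \<open>p > 0\<close> by auto
  also have "(\<Sum>k\<in>\<dots>. of_nat (p choose k) * y ^ k) =
      1 + (\<Sum>k\<in>{1..<p}. of_nat (p choose k) * y ^ k) + y ^ p"
    using \<open>p > 0\<close> by (subst sum.union_disjoint; simp)+
  also have "(\<Sum>k\<in>{1..<p}. of_nat (p choose k) * y ^ k) = of_nat p * w"
    unfolding w_def sum_distrib_left
  proof (rule sum.cong)
    fix k assume "k \<in> {1..<p}"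
    then have "p dvd (p choose k)" using dvd_choose_prime[of k p] p by simp
    then have "(of_nat (p choose k) :: real) = of_nat p * of_nat ((p choose k) div p)"
      by (metis dvd_mult_div_cancel of_nat_mult)
    then show "of_nat (p choose k) * y ^ k = of_nat p * (of_nat ((p choose k) div p) * y ^ k)"
      by simp
  qed simp
  finally have "y ^ p = (x ^ p - 1) - of_nat p * w" by simp
  then have "y ^ p \<in> P" using P_diff[OF xp P_mult[OF p(2) w]] by simp
  then show ?thesis using P_power[OF y] by (simp add: y_def)
qed

text \<open>Each induction step applies \<open>frobenius_one\<close> to \<open>x ^ (p ^ n)\<close>,
  removing one factor \<open>p\<close> from the exponent.\<close>

lemma frobenius_power_one:
  fixes p :: nat
  assumes "Factorial_Ring.prime p" "of_nat p \<in> P" "x \<in> OK" "x ^ (p ^ n) - 1 \<in> P"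
  shows "x - 1 \<in> P"
  using assms(4)
proof (induction n)
  case (Suc n)
  have "(x ^ (p ^ n)) ^ p - 1 \<in> P"
    using Suc.prems by (simp add: power_mult[symmetric] mult.commute)
  then show ?case
    using Suc.IH frobenius_one[OF assms(1,2) OK_power[OF assms(3)]] by blast
qed simp

section \<open>Valuation, congruence and reduction of algebraic integers\<close>

lemma OK_localI:
  assumes "x \<in> A" "A \<subseteq> OK"
  shows "x \<in> {a / s | a s. a \<in> A \<and> s \<in> OK - P}"
  using assms OK_closed(3) one_notin_P by (intro CollectI exI[of _ x] exI[of _ 1]) simp

lemma local_power_0: "x \<in> OK \<Longrightarrow> x \<in> local_power K P 0"
  using OK_localI[of x OK] by (simp add: local_power_def ideals_set_def)

text \<open>The first power of \<open>P\<close> unfolds to the unit ideal times \<open>P\<close>,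
  which is \<open>P\<close>; then the denominator 1 is used.\<close>

lemma local_power_1: 
  assumes "x \<in> P" shows "x \<in> local_power K P 1"
proof -
  have "P [^]\<^bsub>ideals_set (ring_of_ints K)\<^esub> (1::nat) = P"
    using ideal_prod_commute[OF oneideal is_ideal] ideal_prod_one[OF is_ideal]
    by (simp add: ideals_set_def)
  then show ?thesis using OK_localI[of x P] assms a_subset by (simp add: local_power_def)
qed

lemma valuation_nonneg: "x \<in> OK \<Longrightarrow> prime_valuation K P x \<ge> 0"
  unfolding prime_valuation_def using local_power_0 by (intro SUP_upper2[of 0]) auto

lemma cong_mod_primeI:
  assumes "x \<in> OK" "y \<in> OK" "x - y \<in> P"
  shows "cong_mod_prime K P x y"
  using assms OK_localI[of _ OK] local_power_1 by (simp add: cong_mod_prime_def local_ring_def)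

lemma residue_class_eq_iff:
  assumes "a \<in> OK" "b \<in> OK"
  shows "residue_class K P a = residue_class K P b \<longleftrightarrow> a - b \<in> P"
proof
  assume eq: "residue_class K P a = residue_class K P b"
  have "0 \<in> P" using additive_subgroup.zero_closed[OF is_additive_subgroup] by simp
  then have "a \<in> residue_class K P a" by (auto simp: residue_class_def a_r_coset_def')
  then show "a - b \<in> P" unfolding eq by (auto simp: residue_class_def a_r_coset_def')
next
  assume ab: "a - b \<in> P"
  have "i + a \<in> (\<lambda>i. i + b) ` P" if "i \<in> P" for i
    by (rule image_eqI[of _ _ "i + (a - b)"]) (use P_add[OF that ab] in auto)
  moreover have "i + b \<in> (\<lambda>i. i + a) ` P" if "i \<in> P" for i
    by (rule image_eqI[of _ _ "i - (a - b)"]) (use P_diff[OF that ab] in auto)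
  ultimately show "residue_class K P a = residue_class K P b"
    by (auto simp: residue_class_def a_r_coset_def' image_iff)
qed

text \<open>Existence comes from \<open>x = x / 1\<close>. For uniqueness, \<open>x = a / s\<close>
  and \<open>b * s - a \<in> P\<close> give \<open>(b - x) * s \<in> P\<close>, and \<open>s\<close>
  lies outside the prime \<open>P\<close>.\<close>

lemma reduction_OK:
  assumes x: "x \<in> OK"
  shows "reduction K P x = residue_class K P x"
  unfolding reduction_def
proof (rule the_equality)
  have mult: "residue_class K P a \<otimes>\<^bsub>residue_field K P\<^esub> residue_class K P b = residue_class K P (a * b)"
    if "a \<in> OK" "b \<in> OK" for a b
    using rcoset_mult_add[OF that] by (simp add: residue_class_def residue_field_def FactRing_def)
  have carr: "carrier (residue_field K P) = residue_class K P ` OK"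
    by (auto simp: residue_field_def residue_class_def FactRing_def A_RCOSETS_def' )
  show "residue_class K P x \<in> carrier (residue_field K P) \<and>
      (\<exists>a\<in>OK. \<exists>s\<in>OK - P. x = a / s \<and>
        residue_class K P x \<otimes>\<^bsub>residue_field K P\<^esub> residue_class K P s = residue_class K P a)"
    using x OK_closed(3) one_notin_P mult[OF x OK_closed(3)] unfolding carr
    by (intro conjI imageI bexI[of _ x] bexI[of _ 1]) simp_all
  fix c
  assume c: "c \<in> carrier (residue_field K P) \<and>
      (\<exists>a\<in>OK. \<exists>s\<in>OK - P. x = a / s \<and>
        c \<otimes>\<^bsub>residue_field K P\<^esub> residue_class K P s = residue_class K P a)"
  then obtain b a s where b: "b \<in> OK" "c = residue_class K P b" and a: "a \<in> OK"
    and s: "s \<in> OK" "s \<notin> P" and xs: "x = a / s"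
    and eq: "c \<otimes>\<^bsub>residue_field K P\<^esub> residue_class K P s = residue_class K P a"
    unfolding carr by blast
  have "s \<noteq> 0" using s(2) additive_subgroup.zero_closed[OF is_additive_subgroup] by auto
  have "b * s - a \<in> P"
    using eq mult[OF b(1) s(1)] b residue_class_eq_iff[OF OK_closed(2)[OF b(1) s(1)] a] by simp
  then have "(b - x) * s \<in> P" using xs \<open>s \<noteq> 0\<close> by (simp add: left_diff_distrib)
  then have "b - x \<in> P" using P_prime[OF OK_diff[OF b(1) x] s(1)] s(2) by blast
  then show "c = residue_class K P x"
    using residue_class_eq_iff[OF b(1) x] b(2) by simp
qed

end

section \<open>Integrality of \<open>kappa d\<close> and conclusion\<close>

text \<open>The monic polynomial \<open>monom 1 n\<close> takes an algebraic integer value at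
  \<open>x\<close>.\<close>

lemma algebraic_int_of_power:
  fixes x :: real
  assumes "x ^ n = of_nat a" "n > 0"
  shows "algebraic_int x"
  by (rule algebraic_int_root[of "of_nat a" "Polynomial.monom 1 n"])
    (use assms in \<open>auto simp: poly_monom degree_monom_eq\<close>)

theorem theorem5p11:
  fixes d p k :: nat and K :: "real set"
  assumes "d \<ge> 1"
    and "Polynomial.algebraic (kappa d)"
    and "K = rat_adjoin (kappa d)"
    and "Factorial_Ring.prime p" and "k \<ge> 1" and "p ^ k \<in> exact_set d"
  shows "(\<forall>P. prime_above K p P \<longrightarrow> prime_valuation K P (kappa d) \<ge> 0) \<and>
    (\<forall>P. prime_above K p P \<longrightarrow> cong_mod_prime K P (kappa d) 1) \<and>
    kappa_padic d p \<in> padic_principal_units p \<and>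
    (\<forall>P. prime_above K p P \<longrightarrow>
       reduction K P (kappa d) = padic_reduction K P (kappa_padic d p))"
proof -
  \<comment> \<open>Counting grid sets makes the tower start at exponent 0; agreement with
    \<open>num_indep\<close> begins at exponent 1.\<close>
  define c where "c m = int (card (periodic_indep d (p ^ m)))" for m
  have p2: "p \<ge> 2" using assms(4) by (rule prime_ge_2_nat)
  have num: "int (num_indep d (p ^ m)) = c m" if "m \<ge> 1" for m
  proof -
    have "p ^ m \<ge> 2" using p2 self_le_power[of p m] that by linarith
    then show ?thesis by (simp add: c_def num_indep_eq_card_periodic)
  qed
  have tower: "[c (Suc m) = c m] (mod int p ^ Suc m)" for m
    using card_periodic_indep_cong[OF assms(4), of d m]
    by (simp add: c_def cong_int_iff[symmetric])
  have c1: "[c m = 1] (mod int p)" for m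
    using card_periodic_indep_cong_1[OF assms(4,1), of m]
    by (simp add: c_def cong_int_iff[symmetric])
  have p0: "p > 0" "p > 1" using p2 by simp_all
  have limit: "kappa_padic d p = (\<lambda>n. c n mod int p ^ n)"
    using padic_lim_cong_tower(2)[of c p, OF tower p0(1)] num
    by (simp add: kappa_padic_def del: power_Suc)
  have limit_1: "kappa_padic d p 1 = 1"
    using c1[of 1] p0 by (simp add: limit cong_def)
  have "kappa_padic d p \<in> padic_principal_units p"
    using padic_lim_cong_tower(1)[of c p, OF tower p0(1)] p0(2) limit_1
    by (intro padic_principal_unitsI) (simp_all add: limit)
  moreover have "prime_valuation K P (kappa d) \<ge> 0 \<and> cong_mod_prime K P (kappa d) 1 \<and>
      reduction K P (kappa d) = padic_reduction K P (kappa_padic d p)"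
    if P: "prime_above K p P" for P
  proof -
    interpret prime_of_ints K P
      using P by (simp add: prime_of_ints_def prime_above_def)
    have int_P: "of_int m \<in> P \<longleftrightarrow> int p dvd m" for m
      using P by (auto simp: prime_above_def)
    \<comment> \<open>Membership in \<open>exact_set d\<close> gives the exponent
      \<open>(p ^ k) ^ d\<close>; written as a single power of \<open>p\<close> it fits the
      Frobenius argument.\<close>
    have power: "kappa d ^ (p ^ (k * d)) = real (num_indep d (p ^ k))"
      using assms(6) by (simp add: exact_set_def power_mult)
    have "kappa d \<in> K"
      unfolding assms(3) rat_adjoin_def by (rule generate_field.incl) simp
    then have kappa_OK: "kappa d \<in> OK"
      using algebraic_int_of_power[OF power] p0 by (simp add: OK_iff)
    have "int p dvd c k - 1" using c1[of k] by (simp add: cong_iff_dvd_diff)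
    then have "kappa d ^ (p ^ (k * d)) - 1 \<in> P"
      using int_P[of "c k - 1"] by (simp add: power num[OF assms(5), symmetric])
    moreover have "of_nat p \<in> P" using int_P[of "int p"] by simp
    ultimately have kappa_1: "kappa d - 1 \<in> P"
      using frobenius_power_one[OF assms(4) _ kappa_OK] by blast
    \<comment> \<open>Both reductions are the class of 1: on the p-adic side component 1 of the
      limit is 1 by \<open>limit_1\<close>.\<close>
    have "reduction K P (kappa d) = residue_class K P 1"
      using reduction_OK[OF kappa_OK] residue_class_eq_iff[OF kappa_OK OK_closed(3)] kappa_1
      by simp
    then show ?thesis
      using valuation_nonneg[OF kappa_OK] cong_mod_primeI[OF kappa_OK OK_closed(3) kappa_1]
        limit_1 by (simp add: padic_reduction_def)
  qed
  ultimately show ?thesis by simp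
qed

end
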